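(* Let $(P,\preceq)$ be a locally finite lattice and let $f:P\to\mathbb{C}$ be semimultiplicative with $f(x)\neq0$ for all $x\in P$. Let $S=\{x_1,\dots,x_n\}\subseteq P$ be indexed so that $x_i\preceq x_j\Rightarrow i\le j$, let $D=\{d_1,\dots,d_m\}$ be any finite subset of $P$ containing all $x_i\vee x_j$, indexed so that $d_i\preceq d_j\Rightarrow i\le j$, and let $S_i=S\setminus\{x_i\}$. If $(S)_f$ is invertible, then its inverse is the $n\times n$ matrix $B=(b_{ij})$ with $$b_{ij}=\frac{(-1)^{i+j}}{f(x_i)f(x_j)\det(S)_f}\Big(\prod_{v=1}^n f(x_v)^2\Big)\sum_{1\le k_1<\cdots<k_{n-1}\le m}\det E(S_i)_{(k_1,\dots,k_{n-1})}\det E(S_j)_{(k_1,\dots,k_{n-1})}\,\Psi_{D,1/f}(d_{k_1})\cdots\Psi_{D,1/f}(d_{k_{n-1}}).$$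
   Context: $f$ is semimultiplicative if $f(x)f(y)=f(x\wedge y)f(x\vee y)$ for all $x,y\in P$. $(S)_f$ is the $n\times n$ matrix with $(i,j)$ entry $f(x_i\wedge x_j)$. $\Psi_{D,1/f}$ is defined on $D$ recursively by $\Psi_{D,1/f}(d_k)=1/f(d_k)-\sum_{d_v\in D,\ d_k\prec d_v}\Psi_{D,1/f}(d_v)$. $E(S)$ is the $n\times m$ matrix with $(i,j)$ entry $1$ if $x_i\preceq d_j$ and $0$ otherwise, and $E(S_i)$ is $E(S)$ with row $i$ deleted. $A_{(k_1,\dots,k_r)}$ denotes the $r\times r$ submatrix of an $r\times m$ matrix $A$ consisting of columns $k_1<\dots<k_r$. *)

theory Defs
  imports Complex_Main "Jordan_Normal_Form.Determinant" "Jordan_Normal_Form.DL_Submatrix"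
begin

text \<open>
  Finite subsets of the lattice are given by enumerations \<open>x 0, \<dots>, x (n - 1)\<close> and
  \<open>d 0, \<dots>, d (m - 1)\<close>. Indices start at \<open>0\<close>, as for matrices; shifting both \<open>i\<close> and \<open>j\<close> by one
  does not affect the sign \<open>(-1) ^ (i + j)\<close>.
\<close>

definition semimultiplicative :: "('a::lattice \<Rightarrow> complex) \<Rightarrow> bool" where
  "semimultiplicative f \<longleftrightarrow> (\<forall>x y. f x * f y = f (inf x y) * f (sup x y))"

definition meet_matrix :: "nat \<Rightarrow> (nat \<Rightarrow> 'a::lattice) \<Rightarrow> ('a \<Rightarrow> complex) \<Rightarrow> complex mat" where
  "meet_matrix n x f = mat n n (\<lambda>(i, j). f (inf (x i) (x j)))"

text \<open>
  The recursion runs downwards through \<open>D\<close> and terminates only for finite \<open>D\<close>; the value for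
  infinite \<open>D\<close> is a dummy.
\<close>

function Psi :: "'a::order set \<Rightarrow> ('a \<Rightarrow> complex) \<Rightarrow> 'a \<Rightarrow> complex" where
  "Psi D g a = (if finite D then g a - (\<Sum>b\<in>{b \<in> D. a < b}. Psi D g b) else 0)"
  by pat_completeness auto
termination
proof (relation "measure (\<lambda>(D, g, a). card {b \<in> D. a < b})")
  fix D :: "'a set" and g :: "'a \<Rightarrow> complex" and a b
  assume "finite D" and "b \<in> {b \<in> D. a < b}"
  then have "{c \<in> D. b < c} \<subset> {c \<in> D. a < c}" and "finite {c \<in> D. a < c}"
    by auto
  then show "((D, g, b), (D, g, a)) \<in> measure (\<lambda>(D, g, a). card {b \<in> D. a < b})"
    by (simp add: psubset_card_mono)
qed simp

declare Psi.simps [simp del]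

definition E_mat ::
  "nat \<Rightarrow> (nat \<Rightarrow> 'a::order) \<Rightarrow> nat \<Rightarrow> (nat \<Rightarrow> 'a) \<Rightarrow> complex mat" where
  "E_mat n x m d = mat n m (\<lambda>(i, j). if x i \<le> d j then 1 else 0)"

definition delete_row :: "nat \<Rightarrow> 'a mat \<Rightarrow> 'a mat" where
  "delete_row i A = submatrix A (- {i}) UNIV"

text \<open>
  Column indices \<open>k\<^sub>1 < \<dots> < k\<^sub>r\<close> are encoded as the set \<open>K = {k\<^sub>1, \<dots>, k\<^sub>r}\<close>;
  \<^const>\<open>submatrix\<close> lists the selected columns in increasing order.
\<close>

definition select_columns :: "'a mat \<Rightarrow> nat set \<Rightarrow> 'a mat" where
  "select_columns A K = submatrix A UNIV K"

end

theory Submission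
  imports Defs
begin

text \<open>
  By semimultiplicativity the entry of \<open>(S)\<^sub>f\<close> at \<open>(i, j)\<close> is
  \<open>f(x\<^sub>i) f(x\<^sub>j) / f(x\<^sub>i \<or> x\<^sub>j)\<close>, and unfolding the recursion of \<open>\<Psi>\<close> at
  \<open>x\<^sub>i \<or> x\<^sub>j \<in> D\<close> gives \<open>(S)\<^sub>f = \<Delta> E \<Lambda> E\<^sup>T \<Delta>\<close> with \<open>\<Delta> = diag (f(x\<^sub>i))\<close> and
  \<open>\<Lambda> = diag (\<Psi>(d\<^sub>k))\<close>. A cofactor of \<open>(S)\<^sub>f\<close> is therefore, up to the deleted diagonal factors,
  the determinant of \<open>E(S\<^sub>i) \<Lambda> E(S\<^sub>j)\<^sup>T\<close>, which the Cauchy-Binet formula expands into the sum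
  over column selections. The adjugate formula gives the inverse.
\<close>

section \<open>The Cauchy-Binet formula\<close>

text \<open>Below \<open>card K\<close> the map \<open>pick K\<close> is strictly increasing, hence
  injective; equal cardinalities then make it onto.\<close>

lemma bij_betw_pick:
  assumes "finite K"
  shows "bij_betw (pick K) {0..<card K} K"
proof -
  have inj: "inj_on (pick K) {0..<card K}"
    by (rule linorder_inj_onI) (auto dest: pick_mono_le[of _ K])
  moreover have "pick K ` {0..<card K} \<subseteq> K"
    using pick_in_set_le by auto
  ultimately show ?thesis
    using assms by (simp add: bij_betw_def card_image card_subset_eq)
qed

lemma select_columns_eq:
  assumes "A \<in> carrier_mat r m" and "K \<subseteq> {..<m}"
  shows "select_columns A K = mat r (card K) (\<lambda>(i, j). A $$ (i, pick K j))"
proof -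
  have "{j. j < m \<and> j \<in> K} = K"
    using assms by auto
  then show ?thesis
    using assms by (auto simp: select_columns_def submatrix_def pick_UNIV)
qed

text \<open>Outside \<open>{0..<r}\<close> the selections are the identity, as in \<open>det_linear_rows_sum\<close>.\<close>

lemma sum_injective_selections:
  fixes m r :: nat and g :: "(nat \<Rightarrow> nat) \<Rightarrow> 'b::comm_monoid_add"
  defines "\<K> \<equiv> {K. K \<subseteq> {..<m} \<and> card K = r}"
  shows "(\<Sum>h\<in>{h. (\<forall>i\<in>{0..<r}. h i \<in> {0..<m}) \<and> (\<forall>i. i \<notin> {0..<r} \<longrightarrow> h i = i) \<and> inj_on h {0..<r}}. g h)
    = (\<Sum>K\<in>\<K>. \<Sum>q\<in>{q. q permutes {0..<r}}. g (\<lambda>i. if i < r then pick K (q i) else i))"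
    (is "sum g ?I = _")
proof -
  let ?P = "{q. q permutes {0..<r}}"
  let ?rank = "\<lambda>h i. if i < r then card {a \<in> h ` {0..<r}. a < h i} else i"
  have "sum g ?I = (\<Sum>(K, q)\<in>\<K> \<times> ?P. g (\<lambda>i. if i < r then pick K (q i) else i))"
  \<comment> \<open>An injective \<open>h\<close> corresponds to its image \<open>K\<close> together
    with the permutation sending \<open>i\<close> to the rank of \<open>h i\<close> in
    \<open>K\<close>. The inverse composes \<open>pick K\<close> with the permutation.\<close>
  proof (rule sum.reindex_bij_witness[where
        i = "\<lambda>(K, q) i. if i < r then pick K (q i) else i" and
        j = "\<lambda>h. (h ` {0..<r}, ?rank h)"], goal_cases)
    case (1 h)
    then show ?case
      by (auto simp: pick_card_in_set)
  next
    case (2 h)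
    then have inj: "inj_on h {0..<r}"
      by simp
    let ?K = "h ` {0..<r}"
    have card: "card ?K = r"
      using inj by (simp add: card_image)
    have "inj_on (?rank h) {0..<r}"
    proof (rule inj_onI)
      fix i j assume ij: "i \<in> {0..<r}" "j \<in> {0..<r}" "?rank h i = ?rank h j"
      then have "pick ?K (card {a \<in> ?K. a < h i}) = pick ?K (card {a \<in> ?K. a < h j})"
        by simp
      then have "h i = h j"
        using ij(1,2) by (simp only: pick_card_in_set imageI)
      then show "i = j"
        using inj ij by (auto dest: inj_onD)
    qed
    moreover have "?rank h i < r" if "i < r" for i
    proof -
      \<comment> \<open>The inclusion is strict because \<open>h i\<close> lies in the image but not
        below itself, so ranks stay below \<open>r\<close>.\<close>
      have "{a \<in> ?K. a < h i} \<subset> ?K"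
        using that by auto
      then have "card {a \<in> ?K. a < h i} < card ?K"
        by (intro psubset_card_mono) auto
      then show ?thesis
        using card that by simp
    qed
    ultimately have "?rank h permutes {0..<r}"
      by (intro inj_on_nat_permutes) auto
    with 2 card show ?case
      by (auto simp: \<K>_def)
  next
    case (3 Kq)
    then obtain K q where Kq: "Kq = (K, q)" "K \<in> \<K>" "q permutes {0..<r}"
      by auto
    then have K: "finite K" "card K = r"
      by (auto simp: \<K>_def intro: finite_subset)
    have qr: "q i < r" if "i < r" for i
      using permutes_in_image[OF Kq(3), of i] that by auto
    define h where "h = (\<lambda>i. if i < r then pick K (q i) else i)"
    have "h ` {0..<r} = pick K ` q ` {0..<r}"
      by (auto simp: h_def image_image)
    then have img: "h ` {0..<r} = K"
      using bij_betw_pick[OF K(1)] K(2) permutes_image[OF Kq(3)] by (simp add: bij_betw_def)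
    \<comment> \<open>Exactly \<open>q i\<close> elements of \<open>K\<close> lie below
      \<open>pick K (q i)\<close>; from \<open>r\<close> on, both sides are
      \<open>i\<close>.\<close>
    have "?rank h i = q i" for i
      using card_pick_le[of "q i" K] qr K permutes_not_in[OF Kq(3), of i]
      unfolding img by (auto simp: h_def)
    then have "?rank h = q"
      by blast
    with img show ?case
      by (simp only: Kq(1) h_def prod.case)
  next
    case (4 Kq)
    then obtain K q where Kq: "Kq = (K, q)" "K \<in> \<K>" "q permutes {0..<r}"
      by auto
    then have K: "finite K" "card K = r" "K \<subseteq> {..<m}"
      by (auto simp: \<K>_def intro: finite_subset)
    have qr: "q i < r" if "i < r" for i
      using permutes_in_image[OF Kq(3), of i] that by auto
    have "inj_on (pick K \<circ> q) {0..<r}"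
      using bij_betw_pick[OF K(1)] K(2) permutes_image[OF Kq(3)]
      by (intro comp_inj_on permutes_inj_on[OF Kq(3)]) (simp add: bij_betw_def)
    then have "inj_on (\<lambda>i. if i < r then pick K (q i) else i) {0..<r}"
      by (simp add: inj_on_def)
    moreover have "pick K (q i) < m" if "i < r" for i
      using pick_in_set_le[of "q i" K] qr[OF that] K by auto
    ultimately show ?case
      using Kq(1) by auto
  next
    case (5 h)
    have "(\<lambda>i. if i < r then pick (h ` {0..<r}) (?rank h i) else i) = h"
      using 5 by (auto simp: pick_card_in_set)
    then show ?case
      by simp
  qed
  then show ?thesis
    by (simp add: sum.cartesian_product)
qed

text \<open>The rows of \<open>A * B\<close> are combinations of rows of \<open>B\<close>.
  Multilinearity gives a sum over all row selections; those with a repeated row contribute 0, and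
  the injective ones with image \<open>K\<close> add up to the Leibniz expansion of a minor of
  \<open>A\<close> times a minor of \<open>B\<close>.\<close>

theorem Cauchy_Binet:
  fixes A B :: "'a::comm_ring_1 mat"
  assumes A: "A \<in> carrier_mat r m" and B: "B \<in> carrier_mat m r"
  shows "det (A * B) = (\<Sum>K\<in>{K. K \<subseteq> {..<m} \<and> card K = r}.
    det (select_columns A K) * det (select_columns (transpose_mat B) K))"
proof -
  let ?F = "{h. (\<forall>i\<in>{0..<r}. h i \<in> {0..<m}) \<and> (\<forall>i. i \<notin> {0..<r} \<longrightarrow> h i = i)}"
  let ?I = "{h. (\<forall>i\<in>{0..<r}. h i \<in> {0..<m}) \<and> (\<forall>i. i \<notin> {0..<r} \<longrightarrow> h i = i) \<and> inj_on h {0..<r}}"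
  let ?P = "{q. q permutes {0..<r}}"
  define R where "R h = mat\<^sub>r r r (\<lambda>i. row B (h i))" for h
  define g where "g h = (\<Prod>i\<in>{0..<r}. A $$ (i, h i)) * det (R h)" for h
  have R: "R h \<in> carrier_mat r r" for h
    by (simp add: R_def)
  have finF: "finite ?F"
    by (rule finite_bounded_functions) auto
  have "det (A * B) = (\<Sum>h\<in>?F. det (mat\<^sub>r r r (\<lambda>i. A $$ (i, h i) \<cdot>\<^sub>v row B (h i))))"
    unfolding mat_mul_finsum_alt[OF A B]
    by (rule det_linear_rows_sum) (use A B in auto)
  also have "\<dots> = (\<Sum>h\<in>?F. g h)"
    unfolding g_def R_def by (intro sum.cong refl det_rows_mul) (use B in auto)
  also have "\<dots> = (\<Sum>h\<in>?I. g h)"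
  proof (rule sum.mono_neutral_right[OF finF])
    show "\<forall>h\<in>?F - ?I. g h = 0"
    proof
      fix h assume "h \<in> ?F - ?I"
      then obtain i j where ij: "h i = h j" "i \<noteq> j" "i < r" "j < r"
        unfolding inj_on_def by auto
      have "row (R h) i = row (R h) j"
        using ij B by (simp add: R_def)
      then have "det (R h) = 0"
        using det_identical_rows[OF R ij(2-4)] by blast
      then show "g h = 0"
        by (simp add: g_def)
    qed
  qed auto
  also have "\<dots> = (\<Sum>K\<in>{K. K \<subseteq> {..<m} \<and> card K = r}. \<Sum>q\<in>?P.
      g (\<lambda>i. if i < r then pick K (q i) else i))"
    by (rule sum_injective_selections)
  also have "\<dots> = (\<Sum>K\<in>{K. K \<subseteq> {..<m} \<and> card K = r}.
      det (select_columns A K) * det (select_columns (transpose_mat B) K))"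
  proof (rule sum.cong[OF refl])
    fix K assume "K \<in> {K. K \<subseteq> {..<m} \<and> card K = r}"
    then have K: "K \<subseteq> {..<m}" "card K = r"
      by auto
    have pick: "pick K i < m" if "i < r" for i
      using pick_in_set_le[of i K] that K by auto
    \<comment> \<open>A minor of \<open>B\<close> keeps rows while \<open>select_columns\<close>
      keeps columns; transposition reconciles the two without changing the determinant.\<close>
    define BK where "BK = mat r r (\<lambda>(i, j). B $$ (pick K i, j))"
    have BK: "BK \<in> carrier_mat r r"
      by (simp add: BK_def)
    have "select_columns (transpose_mat B) K = transpose_mat BK"
      using B K pick by (subst select_columns_eq[of _ r m]) (auto simp: BK_def)
    then have detB: "det (select_columns (transpose_mat B) K) = det BK"
      using det_transpose[OF BK] by simp
    have AK: "select_columns A K = mat r r (\<lambda>(i, j). A $$ (i, pick K j))"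
      using select_columns_eq[OF A K(1)] K(2) by simp
    have "g (\<lambda>i. if i < r then pick K (q i) else i)
        = signof q * (\<Prod>i\<in>{0..<r}. select_columns A K $$ (i, q i)) * det BK"
      if q: "q permutes {0..<r}" for q
    proof -
      have qr: "q i < r" if "i < r" for i
        using permutes_in_image[OF q, of i] that by auto
      \<comment> \<open>The selected rows are those of \<open>BK\<close> permuted by
        \<open>q\<close>, which is where the sign in the Leibniz expansion comes from.\<close>
      have "R (\<lambda>i. if i < r then pick K (q i) else i) = mat r r (\<lambda>(i, j). BK $$ (q i, j))"
        by (rule eq_matI) (use B pick qr in \<open>auto simp: R_def BK_def\<close>)
      then have "det (R (\<lambda>i. if i < r then pick K (q i) else i)) = signof q * det BK"
        using det_permute_rows[OF BK q] by simp
      moreover have "(\<Prod>i\<in>{0..<r}. A $$ (i, if i < r then pick K (q i) else i))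
          = (\<Prod>i\<in>{0..<r}. select_columns A K $$ (i, q i))"
        by (rule prod.cong) (auto simp: AK qr)
      ultimately show ?thesis
        by (simp add: g_def mult_ac)
    qed
    then have "(\<Sum>q\<in>?P. g (\<lambda>i. if i < r then pick K (q i) else i))
        = (\<Sum>q\<in>?P. signof q * (\<Prod>i\<in>{0..<r}. select_columns A K $$ (i, q i))) * det BK"
      unfolding sum_distrib_right by (intro sum.cong) auto
    also have "\<dots> = det (select_columns A K) * det BK"
      by (subst det_def'[of _ r]) (auto simp: AK)
    finally show "(\<Sum>q\<in>?P. g (\<lambda>i. if i < r then pick K (q i) else i))
        = det (select_columns A K) * det (select_columns (transpose_mat B) K)"
      by (simp add: detB)
  qed
  finally show ?thesis .
qed

section \<open>Diagonal scalings and a weighted Cauchy-Binet formula\<close>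

text \<open>Every Leibniz product meets each row and each column once, so it carries all factors
  \<open>u i\<close> and all factors \<open>v j\<close>.\<close>

lemma det_scale_rows_columns:
  fixes G :: "nat \<Rightarrow> nat \<Rightarrow> 'a::comm_ring_1"
  shows "det (mat r r (\<lambda>(i, j). u i * v j * G i j))
    = (\<Prod>i<r. u i) * (\<Prod>j<r. v j) * det (mat r r (\<lambda>(i, j). G i j))"
proof -
  have "signof p * (\<Prod>i\<in>{0..<r}. mat r r (\<lambda>(i, j). u i * v j * G i j) $$ (i, p i))
      = (\<Prod>i<r. u i) * (\<Prod>j<r. v j)
        * (signof p * (\<Prod>i\<in>{0..<r}. mat r r (\<lambda>(i, j). G i j) $$ (i, p i)))"
    if p: "p permutes {0..<r}" for p
  proof -
    have pr: "p i < r" if "i < r" for i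
      using permutes_in_image[OF p, of i] that by auto
    have "(\<Prod>i\<in>{0..<r}. mat r r (\<lambda>(i, j). u i * v j * G i j) $$ (i, p i))
        = (\<Prod>i\<in>{0..<r}. u i) * (\<Prod>i\<in>{0..<r}. v (p i))
          * (\<Prod>i\<in>{0..<r}. mat r r (\<lambda>(i, j). G i j) $$ (i, p i))"
      unfolding prod.distrib[symmetric] by (rule prod.cong) (auto simp: pr)
    moreover have "(\<Prod>i\<in>{0..<r}. v (p i)) = (\<Prod>i\<in>{0..<r}. v i)"
      using prod.permute[OF p, of v] by (simp add: o_def)
    ultimately show ?thesis
      by (simp add: atLeast0LessThan mult_ac)
  qed
  then show ?thesis
    by (subst (1 2) det_def'[of _ r]) (auto simp: sum_distrib_left intro!: sum.cong)
qed

text \<open>The diagonal weights are absorbed into the second factor, and each choice of columns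
  \<open>K\<close> releases the product of its weights. This is the form needed for E(S_i) \<Lambda>
  E(S_j)^T.\<close>

corollary Cauchy_Binet_weighted:
  fixes A C :: "'a::comm_ring_1 mat"
  assumes A: "A \<in> carrier_mat r m" and C: "C \<in> carrier_mat r m"
  shows "det (mat r r (\<lambda>(i, j). \<Sum>k<m. A $$ (i, k) * C $$ (j, k) * w k))
    = (\<Sum>K\<in>{K. K \<subseteq> {..<m} \<and> card K = r}.
        det (select_columns A K) * det (select_columns C K) * (\<Prod>k\<in>K. w k))"
proof -
  define W where "W = mat m r (\<lambda>(k, j). w k * C $$ (j, k))"
  have W: "W \<in> carrier_mat m r"
    by (simp add: W_def)
  have "mat r r (\<lambda>(i, j). \<Sum>k<m. A $$ (i, k) * C $$ (j, k) * w k) = A * W"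
    by (rule eq_matI) (use A in \<open>auto simp: W_def scalar_prod_def atLeast0LessThan mult_ac intro!: sum.cong\<close>)
  moreover have "det (select_columns (transpose_mat W) K)
      = det (select_columns C K) * (\<Prod>k\<in>K. w k)" if K: "K \<subseteq> {..<m}" "card K = r" for K
  proof -
    have fin: "finite K"
      using K finite_subset by blast
    have pick: "pick K i < m" if "i < r" for i
      using pick_in_set_le[of i K] that K by auto
    have "select_columns (transpose_mat W) K = mat r r (\<lambda>(i, j). 1 * w (pick K j) * C $$ (i, pick K j))"
      using K pick by (subst select_columns_eq[of _ r m]) (auto simp: W_def)
    moreover have "select_columns C K = mat r r (\<lambda>(i, j). C $$ (i, pick K j))"
      using select_columns_eq[OF C K(1)] K(2) by simp
    moreover have "(\<Prod>j<r. w (pick K j)) = (\<Prod>k\<in>K. w k)"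
      using prod.reindex_bij_betw[OF bij_betw_pick[OF fin], of w] K(2) by (simp add: atLeast0LessThan)
    ultimately show ?thesis
      using det_scale_rows_columns[of r "\<lambda>_. 1" "\<lambda>j. w (pick K j)" "\<lambda>i j. C $$ (i, pick K j)"]
      by (simp add: mult_ac)
  qed
  ultimately show ?thesis
    unfolding \<open>mat r r _ = A * W\<close> Cauchy_Binet[OF A W]
    by (auto simp: mult_ac intro!: sum.cong)
qed

section \<open>Meet matrices\<close>

text \<open>Exactly \<open>a\<close> indices other than \<open>i\<close> lie below
  \<open>insert_index i a\<close>. This matches the row numbering of \<open>submatrix\<close> with
  that of \<open>mat_delete\<close>.\<close>

lemma pick_Compl_singleton: "pick (- {i}) a = insert_index i a"
proof -
  have "{c \<in> - {i}. c < insert_index i a} = (if a < i then {..<a} else {..a} - {i})"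
    by (auto simp: insert_index_def)
  then have "card {c \<in> - {i}. c < insert_index i a} = a"
    by auto
  then show ?thesis
    using pick_card_in_set[of "insert_index i a" "- {i}"] by (auto simp: insert_index_def)
qed

lemma delete_row_eq:
  assumes "A \<in> carrier_mat n m" and "i < n"
  shows "delete_row i A = mat (n - 1) m (\<lambda>(a, b). A $$ (insert_index i a, b))"
proof -
  have "{a. a < n \<and> a \<in> - {i}} = {..<n} - {i}"
    by auto
  then have "card {a. a < n \<and> a \<in> - {i}} = n - 1"
    using assms by simp
  then show ?thesis
    using assms by (auto simp: delete_row_def submatrix_def pick_UNIV pick_Compl_singleton)
qed

text \<open>\<open>insert_index i\<close> enumerates the indices below \<open>n\<close> other than
  \<open>i\<close>; the result gives the diagonal factors that survive in a minor.\<close>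

lemma prod_insert_index:
  fixes u :: "nat \<Rightarrow> 'a::field"
  assumes "i < n" and "u i \<noteq> 0"
  shows "(\<Prod>a<n - 1. u (insert_index i a)) = (\<Prod>v<n. u v) / u i"
proof -
  obtain l where n: "n = Suc l"
    using assms by (cases n) auto
  have "inj_on (insert_index i) {0..<l}"
    by (auto simp: inj_on_def insert_index_def split: if_splits)
  then have "(\<Prod>a\<in>{0..<l}. u (insert_index i a)) = (\<Prod>v\<in>{0..<n} - {i}. u v)"
    using prod.reindex[of "insert_index i" "{0..<l}" u] insert_index_image[of i l] assms n
    by (simp add: o_def)
  also have "\<dots> = (\<Prod>v\<in>{0..<n}. u v) / u i"
    using assms by (simp add: prod_diff1)
  finally show ?thesis
    by (simp add: n atLeast0LessThan)
qed

lemma sum_Psi_above: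
  assumes "finite D" and "a \<in> D"
  shows "(\<Sum>b\<in>{b \<in> D. a \<le> b}. Psi D g b) = g a"
proof -
  have "{b \<in> D. a \<le> b} = insert a {b \<in> D. a < b}"
    using assms by auto
  then show ?thesis
    using assms Psi.simps[of D g a] by simp
qed

lemma invertible_mat_imp_det_nonzero:
  fixes A :: "'a::comm_ring_1 mat"
  assumes "A \<in> carrier_mat n n" and "invertible_mat A"
  shows "det A \<noteq> 0"
proof -
  obtain B where B: "A * B = 1\<^sub>m n" "B * A = 1\<^sub>m (dim_row B)"
    using assms by (auto simp: invertible_mat_def inverts_mat_def)
  \<comment> \<open>The shape of \<open>B\<close> is not given in advance; it is read off from the
    column counts of the two identities.\<close>
  have "dim_col B = n" "dim_row B = n"
    using assms(1) arg_cong[OF B(1), of dim_col] arg_cong[OF B(2), of dim_col] by auto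
  then have "B \<in> carrier_mat n n"
    by auto
  then have "det A * det B = 1"
    using det_mult[OF assms(1), of B] B(1) by simp
  then show ?thesis
    by auto
qed

section \<open>Factorization of the meet matrix, its cofactors and its inverse\<close>

text \<open>The two incidence entries are both 1 exactly when \<open>d k\<close> lies above the
  join, so the sum collapses to the reciprocal of \<open>f\<close> at the join. Semimultiplicativity
  turns this into the value at the meet.\<close>

lemma meet_matrix_entry:
  fixes f :: "'a::lattice \<Rightarrow> complex"
  assumes semimult: "semimultiplicative f" and nonzero: "\<And>a. f a \<noteq> 0"
    and d: "bij_betw d {..<m} D" and join: "sup (x i) (x j) \<in> D"
    and ij: "i < n" "j < n"
  shows "meet_matrix n x f $$ (i, j) = f (x i) * f (x j) *
    (\<Sum>k<m. E_mat n x m d $$ (i, k) * E_mat n x m d $$ (j, k) * Psi D (\<lambda>a. 1 / f a) (d k))"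
proof -
  let ?\<Psi> = "Psi D (\<lambda>a. 1 / f a)"
  have fin: "finite D"
    using d bij_betw_finite by blast
  have "(\<Sum>k<m. E_mat n x m d $$ (i, k) * E_mat n x m d $$ (j, k) * ?\<Psi> (d k))
      = (\<Sum>k<m. if sup (x i) (x j) \<le> d k then ?\<Psi> (d k) else 0)"
    by (rule sum.cong) (use ij in \<open>auto simp: E_mat_def\<close>)
  also have "\<dots> = (\<Sum>b\<in>D. if sup (x i) (x j) \<le> b then ?\<Psi> b else 0)"
    by (rule sum.reindex_bij_betw[OF d])
  also have "\<dots> = (\<Sum>b\<in>{b \<in> D. sup (x i) (x j) \<le> b}. ?\<Psi> b)"
    using fin by (simp add: sum.inter_filter)
  also have "\<dots> = 1 / f (sup (x i) (x j))"
    using sum_Psi_above[OF fin join, of "\<lambda>a. 1 / f a"] .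
  finally have sum: "(\<Sum>k<m. E_mat n x m d $$ (i, k) * E_mat n x m d $$ (j, k) * ?\<Psi> (d k))
    = 1 / f (sup (x i) (x j))" .
  have "f (inf (x i) (x j)) = f (x i) * f (x j) / f (sup (x i) (x j))"
    using semimult nonzero by (simp add: semimultiplicative_def eq_divide_eq)
  then show ?thesis
    unfolding sum using ij by (simp add: meet_matrix_def)
qed

text \<open>Deleting row \<open>i\<close> and column \<open>j\<close> keeps the factorization, with
  the rows of the two incidence factors and the diagonal factors deleted accordingly; the weighted
  Cauchy-Binet formula then applies.\<close>

lemma cofactor_meet_matrix:
  fixes f :: "'a::lattice \<Rightarrow> complex"
  assumes semimult: "semimultiplicative f" and nonzero: "\<And>a. f a \<noteq> 0"
    and d: "bij_betw d {..<m} D"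
    and joins: "\<And>i j. i < n \<Longrightarrow> j < n \<Longrightarrow> sup (x i) (x j) \<in> D"
    and ij: "i < n" "j < n"
  shows "cofactor (meet_matrix n x f) i j = (-1) ^ (i + j) / (f (x i) * f (x j))
    * (\<Prod>v<n. (f (x v))\<^sup>2)
    * (\<Sum>K \<in> {K. K \<subseteq> {..<m} \<and> card K = n - 1}.
         det (select_columns (delete_row i (E_mat n x m d)) K)
           * det (select_columns (delete_row j (E_mat n x m d)) K)
           * (\<Prod>k\<in>K. Psi D (\<lambda>a. 1 / f a) (d k)))"
proof -
  let ?E = "E_mat n x m d" and ?\<Psi> = "Psi D (\<lambda>a. 1 / f a)"
  define Ei where "Ei l = delete_row l ?E" for l
  have E: "?E \<in> carrier_mat n m"
    by (simp add: E_mat_def)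
  have Ei: "Ei l = mat (n - 1) m (\<lambda>(a, k). ?E $$ (insert_index l a, k))" if "l < n" for l
    using delete_row_eq[OF E that] by (simp add: Ei_def)
  have carrier: "Ei l \<in> carrier_mat (n - 1) m" if "l < n" for l
    by (simp add: Ei[OF that])
  have ins: "insert_index l a < n" if "a < n - 1" for l a
    using that by (auto simp: insert_index_def)
  have "mat_delete (meet_matrix n x f) i j = mat (n - 1) (n - 1) (\<lambda>(a, b).
      f (x (insert_index i a)) * f (x (insert_index j b))
        * (\<Sum>k<m. Ei i $$ (a, k) * Ei j $$ (b, k) * ?\<Psi> (d k)))" (is "_ = ?R")
  proof (rule eq_matI)
    fix a b assume "a < dim_row ?R" "b < dim_col ?R"
    then have ab: "a < n - 1" "b < n - 1"
      by auto
    have "mat_delete (meet_matrix n x f) i j $$ (a, b)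
        = meet_matrix n x f $$ (insert_index i a, insert_index j b)"
      using ab by (simp add: mat_delete_def meet_matrix_def insert_index_def)
    also have "\<dots> = f (x (insert_index i a)) * f (x (insert_index j b))
        * (\<Sum>k<m. ?E $$ (insert_index i a, k) * ?E $$ (insert_index j b, k) * ?\<Psi> (d k))"
      by (rule meet_matrix_entry[OF semimult nonzero d joins]) (use ab ins in auto)
    finally show "mat_delete (meet_matrix n x f) i j $$ (a, b) = ?R $$ (a, b)"
      using ab ij by (simp add: Ei)
  qed (simp_all add: meet_matrix_def)
  \<comment> \<open>Row and column scalings each give the full product with one factor divided out;
    together they produce the squares.\<close>
  then have "det (mat_delete (meet_matrix n x f) i j)
      = (\<Prod>v<n. f (x v)) / f (x i) * ((\<Prod>v<n. f (x v)) / f (x j))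
        * det (mat (n - 1) (n - 1) (\<lambda>(a, b). \<Sum>k<m. Ei i $$ (a, k) * Ei j $$ (b, k) * ?\<Psi> (d k)))"
    using prod_insert_index[of i n "\<lambda>v. f (x v)"] prod_insert_index[of j n "\<lambda>v. f (x v)"]
      ij nonzero
    by (simp only: det_scale_rows_columns simp_thms)
  then show ?thesis
    unfolding Cauchy_Binet_weighted[OF carrier[OF ij(1)] carrier[OF ij(2)]]
    by (simp add: cofactor_def Ei_def power2_eq_square prod.distrib)
qed

theorem theorem6p10:
  fixes f :: "'a::lattice \<Rightarrow> complex"
    and S D :: "'a set"
    and x d :: "nat \<Rightarrow> 'a"
    and n m :: nat
  assumes locally_finite: "\<And>a b :: 'a. finite {a..b}"
    and f_semimult: "semimultiplicative f"
    and f_nonzero: "\<And>a. f a \<noteq> 0"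
    and S_enum: "bij_betw x {..<n} S"
    and S_order: "\<And>i j. i < n \<Longrightarrow> j < n \<Longrightarrow> x i \<le> x j \<Longrightarrow> i \<le> j"
    and D_enum: "bij_betw d {..<m} D"
    and D_order: "\<And>i j. i < m \<Longrightarrow> j < m \<Longrightarrow> d i \<le> d j \<Longrightarrow> i \<le> j"
    and D_joins: "\<And>a b. a \<in> S \<Longrightarrow> b \<in> S \<Longrightarrow> sup a b \<in> D"
    and invertible: "invertible_mat (meet_matrix n x f)"
  defines "B \<equiv> mat n n (\<lambda>(i, j).
      (-1) ^ (i + j) / (f (x i) * f (x j) * det (meet_matrix n x f))
        * (\<Prod>v<n. (f (x v))\<^sup>2)
        * (\<Sum>K \<in> {K. K \<subseteq> {..<m} \<and> card K = n - 1}.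
             det (select_columns (delete_row i (E_mat n x m d)) K)
               * det (select_columns (delete_row j (E_mat n x m d)) K)
               * (\<Prod>k\<in>K. Psi D (\<lambda>a. 1 / f a) (d k))))"
  shows "inverts_mat (meet_matrix n x f) B \<and> inverts_mat B (meet_matrix n x f)"
proof -
  let ?M = "meet_matrix n x f"
  have M: "?M \<in> carrier_mat n n"
    by (simp add: meet_matrix_def)
  have det: "det ?M \<noteq> 0"
    using invertible_mat_imp_det_nonzero[OF M invertible] .
  have joins: "sup (x i) (x j) \<in> D" if "i < n" "j < n" for i j
    using that S_enum by (intro D_joins) (auto simp: bij_betw_def)
  note adj = adj_mat[OF M]
  have B: "B = (1 / det ?M) \<cdot>\<^sub>m adj_mat ?M"
  proof (rule eq_matI)
    fix i j assume "i < dim_row ((1 / det ?M) \<cdot>\<^sub>m adj_mat ?M)" "j < dim_col ((1 / det ?M) \<cdot>\<^sub>m adj_mat ?M)"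
    then have ij: "i < n" "j < n"
      using adj(1) by auto
    \<comment> \<open>The adjugate transposes the cofactors, but the cofactor formula is symmetric
      in the two indices.\<close>
    then have "adj_mat ?M $$ (i, j) = cofactor ?M j i"
      using M by (simp add: adj_mat_def)
    then show "B $$ (i, j) = ((1 / det ?M) \<cdot>\<^sub>m adj_mat ?M) $$ (i, j)"
      using ij adj(1) cofactor_meet_matrix[OF f_semimult f_nonzero D_enum joins ij(2,1)]
      by (simp add: B_def mult_ac add.commute)
  qed (use adj(1) in \<open>auto simp: B_def\<close>)
  have "?M * B = 1\<^sub>m n" "B * ?M = 1\<^sub>m n"
    unfolding B mult_smult_distrib[OF M adj(1)] mult_smult_assoc_mat[OF adj(1) M] adj(2,3)
    using det by (auto intro!: eq_matI)
  then show ?thesis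
    using M by (simp add: inverts_mat_def B_def)
qed

end
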